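(* Let $n,d\ge1$, let $(X_1,Y_1),\dots,(X_n,Y_n)\in\mathbb{R}^d\times\{-1,1\}$ be given data points with empirical distribution $\mathbb{P}_n$, let $\delta>0$, let $q\in(1,\infty]$ and let $p$ be such that $1/p+1/q=1$. Consider the optimal transport discrepancy $\mathcal{D}_c$ with cost function $c((x,y),(u,v))=N_q((x,y),(u,v))$. Then for the log-exponential loss (logistic regression) $$\inf_{\beta\in\mathbb{R}^d}\ \sup_{\mathbb{P}:\,\mathcal{D}_c(\mathbb{P},\mathbb{P}_n)\le\delta}\mathbb{E}_{\mathbb{P}}\big[\log(1+e^{-Y\beta^TX})\big]=\inf_{\beta\in\mathbb{R}^d}\Big\{\frac1n\sum_{i=1}^n\log\big(1+e^{-Y_i\beta^TX_i}\big)+\delta\|\beta\|_p\Big\},$$ and for the hinge loss (support vector machine) $$\inf_{\beta\in\mathbb{R}^d}\ \sup_{\mathbb{P}:\,\mathcal{D}_c(\mathbb{P},\mathbb{P}_n)\le\delta}\mathbb{E}_{\mathbb{P}}\big[(1-Y\beta^TX)^+\big]=\inf_{\beta\in\mathbb{R}^d}\Big\{\frac1n\sum_{i=1}^n(1-Y_i\beta^TX_i)^++\delta\|\beta\|_p\Big\}.$$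
   Context: $\mathbb{P}_n=\frac1n\sum_{i=1}^n\delta_{(X_i,Y_i)}$; $a^+=\max(a,0)$; $\|\cdot\|_q$ is the $\ell_q$-norm. The extended-valued function $N_q$ on $\mathbb{R}^{d+1}\times\mathbb{R}^{d+1}$ is $N_q((x,y),(u,v))=\|x-u\|_q$ if $y=v$ and $N_q((x,y),(u,v))=\infty$ otherwise. For a lower semicontinuous $c:\mathbb{R}^m\times\mathbb{R}^m\to[0,\infty]$ with $c(u,u)=0$ for all $u$, and Borel probability measures $\mathbb{P},\mathbb{Q}$ on $\mathbb{R}^m$, $\mathcal{D}_c(\mathbb{P},\mathbb{Q})=\inf\{\mathbb{E}_\pi[c(U,W)]\}$, the infimum being over all joint distributions $\pi$ of $(U,W)$ on $\mathbb{R}^m\times\mathbb{R}^m$ with marginals $\pi_U=\mathbb{P}$, $\pi_W=\mathbb{Q}$; here $m=d+1$. The supremum runs over Borel probability measures $\mathbb{P}$ on $\mathbb{R}^{d+1}$, and $(X,Y)\sim\mathbb{P}$ under $\mathbb{E}_{\mathbb{P}}$. *)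

theory Defs
  imports "HOL-Probability.Probability"
begin

definition lq_norm :: "ennreal \<Rightarrow> real ^ 'd \<Rightarrow> real" where
  "lq_norm q x =
    (if q = \<infinity> then Max (range (\<lambda>i. \<bar>x $ i\<bar>))
     else (\<Sum>i\<in>UNIV. \<bar>x $ i\<bar> powr enn2real q) powr (1 / enn2real q))"

definition N_cost :: "ennreal \<Rightarrow> (real ^ 'd) \<times> real \<Rightarrow> (real ^ 'd) \<times> real \<Rightarrow> ennreal" where
  "N_cost q = (\<lambda>(x, y) (u, v). if y = v then ennreal (lq_norm q (x - u)) else \<infinity>)"

definition couplings :: "'a::topological_space measure \<Rightarrow> 'a measure \<Rightarrow> ('a \<times> 'a) measure set" where
  "couplings P Q =
    {\<pi>. prob_space \<pi> \<and> sets \<pi> = sets borel \<and> distr \<pi> borel fst = P \<and> distr \<pi> borel snd = Q}"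

definition ot_discrepancy ::
    "('a \<Rightarrow> 'a \<Rightarrow> ennreal) \<Rightarrow> 'a::topological_space measure \<Rightarrow> 'a measure \<Rightarrow> ennreal" where
  "ot_discrepancy c P Q = (INF \<pi>\<in>couplings P Q. \<integral>\<^sup>+ (u, w). c u w \<partial>\<pi>)"

text \<open>The image of the uniform distribution on the indices; the lemma below identifies it
  with the average of the point masses at the data.\<close>

definition empirical_measure :: "nat \<Rightarrow> (nat \<Rightarrow> 'a::topological_space) \<Rightarrow> 'a measure" where
  "empirical_measure n Z = distr (uniform_count_measure {1..n}) borel Z"

lemma emeasure_empirical_measure:
  assumes "n \<ge> 1" "A \<in> sets borel"
  shows "emeasure (empirical_measure n Z) A =
    (\<Sum>i=1..n. emeasure (return borel (Z i)) A) / of_nat n"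
proof -
  have "emeasure (empirical_measure n Z) A =
      emeasure (uniform_count_measure {1..n}) (Z -` A \<inter> {1..n})"
    using assms unfolding empirical_measure_def
    by (subst emeasure_distr) (auto simp: space_uniform_count_measure measurable_def
        sets_uniform_count_measure)
  also have "\<dots> = of_nat (card (Z -` A \<inter> {1..n})) / of_nat n"
    using assms by (subst emeasure_uniform_count_measure)
      (auto simp: divide_ennreal ennreal_of_nat_eq_real_of_nat)
  also have "of_nat (card (Z -` A \<inter> {1..n})) = (\<Sum>i=1..n. emeasure (return borel (Z i)) A)"
    using assms by (simp add: indicator_def sum.If_cases Int_def vimage_def conj_commute)
  finally show ?thesis .
qed

definition ot_ball ::
    "('a \<Rightarrow> 'a \<Rightarrow> ennreal) \<Rightarrow> 'a::topological_space measure \<Rightarrow> real \<Rightarrow> 'a measure set" where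
  "ot_ball c Q \<delta> =
    {P. prob_space P \<and> sets P = sets borel \<and> ot_discrepancy c P Q \<le> ennreal \<delta>}"

end

theory Submission imports Defs begin

text \<open>The identity holds for every fixed \<open>\<beta>\<close> and every nonnegative 1-Lipschitz margin loss \<open>L\<close>
  with \<open>- z \<le> L z\<close>. Along a coupling of \<open>P\<close> with the empirical measure, Hoelder's inequality
  bounds the increase of the loss by \<open>\<parallel>\<beta>\<parallel>\<^sub>p\<close> times the transport cost. Conversely, moving each
  data point with probability \<open>e\<close> over the distance \<open>\<delta> / e\<close> in the direction that attains the dual
  norm costs at most \<open>\<delta>\<close>; since \<open>L\<close> grows with slope 1 towards negative margins, this gains
  \<open>\<delta> * \<parallel>\<beta>\<parallel>\<^sub>p\<close> up to an error of order \<open>e\<close>. Let \<open>e\<close> tend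
  to 0.\<close>

section \<open>The norms and measurability of the transport cost\<close>

lemma lq_norm_nonneg: "0 \<le> lq_norm q x"
  unfolding lq_norm_def by (auto simp: Max_ge_iff)

lemma lq_norm_ennreal:
  "0 \<le> r \<Longrightarrow> lq_norm (ennreal r) x = (\<Sum>i\<in>UNIV. \<bar>x $ i\<bar> powr r) powr (1 / r)"
  by (simp add: lq_norm_def)

lemma lq_norm_top: "lq_norm \<top> x = Max (range (\<lambda>i. \<bar>x $ i\<bar>))"
  by (simp add: lq_norm_def)

lemma lq_norm_one: "lq_norm 1 x = (\<Sum>i\<in>UNIV. \<bar>x $ i\<bar>)"
  by (simp add: lq_norm_def sum_nonneg)

lemma lq_norm_top_le_iff: "lq_norm \<top> x \<le> c \<longleftrightarrow> (\<forall>i. \<bar>x $ i\<bar> \<le> c)"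
  by (auto simp: lq_norm_top)

text \<open>For finite \<open>q\<close> the factor is raised to the exponent and then to its
  reciprocal; for \<open>q = \<infinity>\<close> a monotone map commutes with \<open>Max\<close>.
  Exponent 0 must be excluded: since \<open>1 / 0 = 0\<close>, \<open>lq_norm 0\<close> equals 1 at
  every nonzero vector.\<close>

lemma lq_norm_scaleR:
  assumes "q \<noteq> 0"
  shows "lq_norm q (c *\<^sub>R x) = \<bar>c\<bar> * lq_norm q x"
proof (cases q)
  case top
  have "Max ((\<lambda>t. \<bar>c\<bar> * t) ` range (\<lambda>i. \<bar>x $ i\<bar>)) = \<bar>c\<bar> * Max (range (\<lambda>i. \<bar>x $ i\<bar>))"
    by (rule mono_Max_commute[symmetric]) (auto simp: mono_def mult_left_mono)
  then show ?thesis
    using top by (simp add: lq_norm_def abs_mult image_image)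
next
  case (real r)
  then have "r > 0" using assms by (cases "r = 0") auto
  have "lq_norm q (c *\<^sub>R x) = (\<bar>c\<bar> powr r * (\<Sum>i\<in>UNIV. \<bar>x $ i\<bar> powr r)) powr (1 / r)"
    using real by (simp add: lq_norm_ennreal abs_mult powr_mult sum_distrib_left)
  also have "\<dots> = \<bar>c\<bar> * lq_norm q x"
    using real \<open>r > 0\<close> by (simp add: lq_norm_ennreal powr_mult sum_nonneg powr_powr)
  finally show ?thesis .
qed

lemma borel_measurable_lq_norm [measurable]:
  "(\<lambda>x :: real ^ 'd. lq_norm q x) \<in> borel_measurable borel"
proof -
  have [measurable]: "(\<lambda>x :: real ^ 'd. x $ i) \<in> borel_measurable borel" for i
    by (intro borel_measurable_continuous_onI continuous_intros)
  show ?thesis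
  proof (cases "q = \<infinity>")
    case True
    have "(\<lambda>x :: real ^ 'd. Max ((\<lambda>i. \<bar>x $ i\<bar>) ` UNIV)) \<in> borel_measurable borel"
      by (intro borel_measurable_Max) auto
    then show ?thesis
      using True by (simp add: lq_norm_def)
  qed (simp add: lq_norm_def)
qed

lemma borel_measurable_N_cost [measurable]:
  "(\<lambda>w. N_cost q (fst w) (snd w)) \<in> borel_measurable borel"
proof -
  \<comment> \<open>Couplings live on the Borel sets of the product space, so the components are
    shown measurable by continuity.\<close>
  have [measurable]: "(\<lambda>w :: ((real ^ 'd) \<times> real) \<times> (real ^ 'd) \<times> real. fst (fst w) - fst (snd w))
      \<in> borel_measurable borel"
    by (intro borel_measurable_continuous_onI continuous_intros)
  have [measurable]: "(\<lambda>w :: ((real ^ 'd) \<times> real) \<times> (real ^ 'd) \<times> real. snd (fst w))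
      \<in> borel_measurable borel"
    by (intro borel_measurable_continuous_onI continuous_intros)
  have [measurable]: "(\<lambda>w :: ((real ^ 'd) \<times> real) \<times> (real ^ 'd) \<times> real. snd (snd w))
      \<in> borel_measurable borel"
    by (intro borel_measurable_continuous_onI continuous_intros)
  show ?thesis
    unfolding N_cost_def case_prod_beta by measurable
qed

section \<open>Conjugate exponents, Hoelder's inequality and its equality case\<close>

text \<open>Translates the extended-valued hypotheses into real exponents. The value
  \<open>p = \<infinity>\<close> would give \<open>1 / q = 1\<close>, against \<open>1 < q\<close>,
  and \<open>p = 0\<close> would make the sum of reciprocals infinite.\<close>

lemma conjugate_exponents_cases:
  fixes p q :: ennreal
  assumes "1 < q" "1 / p + 1 / q = 1"
  obtains (one_top) "p = 1" "q = \<infinity>"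
    | (finite) r s where "1 < r" "1 < s" "1 / r + 1 / s = 1" "p = ennreal r" "q = ennreal s"
proof (cases q)
  case top
  then have "1 / p = 1" using assms by simp
  then have "p = 1"
  proof (cases p)
    case (real r)
    then have "r > 0" using \<open>1 / p = 1\<close> by (cases "r = 0") auto
    then have "ennreal (1 / r) = ennreal 1"
      using real \<open>1 / p = 1\<close> divide_ennreal[of 1 r] by simp
    then show ?thesis
      using \<open>r > 0\<close> real by (simp add: ennreal_1[symmetric] del: ennreal_1)
  qed simp
  then show ?thesis using top one_top by simp
next
  case (real s)
  then have s: "1 < s" using assms(1) ennreal_less_iff[of 1 s] by simp
  then have inv_q: "1 / q = ennreal (1 / s)"
    using real by (simp add: divide_ennreal[symmetric])
  show ?thesis
  proof (cases p)
    case top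
    then show ?thesis using assms inv_q s by (simp add: ennreal_1[symmetric] del: ennreal_1)
  next
    case (real r)
    have "r \<noteq> 0" using real assms by auto
    then have "r > 0" using real by simp
    then have "1 / p = ennreal (1 / r)"
      using real by (simp add: divide_ennreal[symmetric])
    then have "ennreal (1 / r + 1 / s) = ennreal 1" 
      using assms inv_q s \<open>r > 0\<close> by (simp add: ennreal_plus)
    then have eq: "1 / r + 1 / s = 1"
      using s \<open>r > 0\<close> by (subst (asm) ennreal_inj) (auto intro: add_nonneg_nonneg)
    then have "1 / r < 1" using s by (smt (verit) divide_pos_pos)
    then have "1 < r" using \<open>r > 0\<close> by simp
    then show ?thesis using finite s eq real \<open>q = ennreal s\<close> by blast
  qed
qed

text \<open>For \<open>q = \<infinity>\<close> each coordinate of \<open>x\<close> is bounded by the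
  maximum. For finite exponents both vectors are normalized and Young's inequality is summed over
  the coordinates.\<close>

lemma lq_norm_Hoelder:
  fixes b x :: "real ^ 'd"
  assumes "1 < q" "1 / p + 1 / q = 1"
  shows "\<bar>b \<bullet> x\<bar> \<le> lq_norm p b * lq_norm q x"
proof -
  have abs_le: "\<bar>b \<bullet> x\<bar> \<le> (\<Sum>i\<in>UNIV. \<bar>b $ i\<bar> * \<bar>x $ i\<bar>)"
    unfolding inner_vec_def by (rule order_trans[OF sum_abs]) (simp add: abs_mult)
  from assms show ?thesis
  proof (cases rule: conjugate_exponents_cases)
    case one_top
    have "(\<Sum>i\<in>UNIV. \<bar>b $ i\<bar> * \<bar>x $ i\<bar>) \<le> (\<Sum>i\<in>UNIV. \<bar>b $ i\<bar> * lq_norm \<top> x)"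
      using lq_norm_top_le_iff[of x "lq_norm \<top> x"] by (intro sum_mono mult_left_mono) auto
    then show ?thesis
      using abs_le one_top by (simp add: lq_norm_one sum_distrib_right)
  next
    case (finite r s)
    define B where "B = (\<Sum>i\<in>UNIV. \<bar>b $ i\<bar> powr r)"
    define S where "S = (\<Sum>i\<in>UNIV. \<bar>x $ i\<bar> powr s)"
    define A where "A = B powr (1 / r)"
    define C where "C = S powr (1 / s)"
    have A: "lq_norm p b = A" and C: "lq_norm q x = C"
      using finite by (simp_all add: lq_norm_ennreal A_def B_def C_def S_def)
    have "B \<ge> 0" "S \<ge> 0" by (simp_all add: B_def S_def sum_nonneg)
    show ?thesis
    proof (cases "B = 0 \<or> S = 0")
      case True
      then have "(\<forall>i. b $ i = 0) \<or> (\<forall>i. x $ i = 0)"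
        using finite by (auto simp: B_def S_def sum_nonneg_eq_0_iff)
      then have "b = 0 \<or> x = 0" by (auto simp: vec_eq_iff)
      then show ?thesis
        by (auto simp: lq_norm_nonneg)
    next
      case False
      then have pos: "B > 0" "S > 0" "A > 0" "C > 0"
        using \<open>B \<ge> 0\<close> \<open>S \<ge> 0\<close> by (auto simp: A_def C_def)
      have pw: "A powr r = B" "C powr s = S"
        using pos finite by (simp_all add: A_def C_def powr_powr)
      \<comment> \<open>The powers of the normalized coordinates sum to 1 for either vector, so
        Young's bound adds up to \<open>1 / r + 1 / s\<close>.\<close>
      have "(\<Sum>i\<in>UNIV. (\<bar>b $ i\<bar> / A) * (\<bar>x $ i\<bar> / C))
          \<le> (\<Sum>i\<in>UNIV. (\<bar>b $ i\<bar> / A) powr r / r + (\<bar>x $ i\<bar> / C) powr s / s)"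
        using finite pos by (intro sum_mono Youngs_inequality) auto
      also have "\<dots> = (\<Sum>i\<in>UNIV. \<bar>b $ i\<bar> powr r) / B / r + (\<Sum>i\<in>UNIV. \<bar>x $ i\<bar> powr s) / S / s"
        using pos by (simp add: powr_divide pw sum.distrib sum_divide_distrib)
      also have "\<dots> = 1"
        using pos finite by (simp add: B_def[symmetric] S_def[symmetric])
      finally have "(\<Sum>i\<in>UNIV. \<bar>b $ i\<bar> * \<bar>x $ i\<bar>) / (A * C) \<le> 1"
        by (simp add: sum_divide_distrib)
      then show ?thesis
        using abs_le pos A C by (simp add: field_simps)
    qed
  qed
qed

text \<open>Supplies the direction in which transport is most effective: the sign vector of
  \<open>b\<close> if \<open>q = \<infinity>\<close>, and otherwise the equality case of Hoelder's
  inequality.\<close>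

lemma lq_norm_dual_attained:
  fixes b :: "real ^ 'd"
  assumes "1 < q" "1 / p + 1 / q = 1"
  obtains h where "lq_norm q h \<le> 1" "b \<bullet> h = lq_norm p b"
proof -
  from assms have "\<exists>h. lq_norm q h \<le> 1 \<and> b \<bullet> h = lq_norm p b"
  proof (cases rule: conjugate_exponents_cases)
    case one_top
    then show ?thesis
      by (intro exI[of _ "\<chi> i. sgn (b $ i)"])
         (auto simp: lq_norm_top_le_iff lq_norm_one inner_vec_def abs_sgn mult.commute sgn_real_def)
  next
    case (finite r s)
    define B where "B = (\<Sum>i\<in>UNIV. \<bar>b $ i\<bar> powr r)"
    have rs: "(r - 1) * s = r" "(r - 1) / r = 1 / s"
      using finite by (auto simp: field_simps)
    show ?thesis
    proof (cases "B = 0")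
      case True
      then have "b = 0" using finite by (auto simp: B_def sum_nonneg_eq_0_iff vec_eq_iff)
      then show ?thesis
        using finite by (intro exI[of _ 0]) (simp add: lq_norm_ennreal)
    next
      case False
      then have B: "B > 0" by (simp add: B_def sum_nonneg less_le)
      \<comment> \<open>The entries are chosen so that the \<open>s\<close>-th power of each modulus
        is proportional to the \<open>r\<close>-th power of that of \<open>b\<close>; the
        denominator makes the \<open>s\<close>-th powers sum to 1.\<close>
      define h :: "real ^ 'd" where "h = (\<chi> i. sgn (b $ i) * \<bar>b $ i\<bar> powr (r - 1) / B powr (1 / s))"
      have "\<bar>h $ i\<bar> powr s = \<bar>b $ i\<bar> powr r / B" for i
        using B finite rs
        by (cases "b $ i = 0") (simp_all add: h_def abs_mult abs_divide powr_divide powr_powr abs_sgn_eq)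
      then have "(\<Sum>i\<in>UNIV. \<bar>h $ i\<bar> powr s) = 1"
        using B by (simp add: sum_divide_distrib[symmetric] B_def[symmetric])
      then have "lq_norm q h \<le> 1"
        using finite by (simp add: lq_norm_ennreal)
      moreover have "b $ i * h $ i = \<bar>b $ i\<bar> powr r / B powr (1 / s)" for i
      proof -
        have "\<bar>b $ i\<bar> powr r = \<bar>b $ i\<bar> * \<bar>b $ i\<bar> powr (r - 1)"
          using powr_mult_base[of "\<bar>b $ i\<bar>" "r - 1"] by simp
        then show ?thesis
          by (simp add: h_def abs_sgn)
      qed
      then have "b \<bullet> h = B / B powr (1 / s)"
        by (simp add: inner_vec_def sum_divide_distrib[symmetric] B_def)
      then have "b \<bullet> h = B powr (1 - 1 / s)"
        using B by (simp add: powr_diff)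
      moreover have "1 - 1 / s = 1 / r" using finite by simp
      ultimately show ?thesis
        using finite by (auto simp: lq_norm_ennreal B_def)
    qed
  qed
  then show ?thesis using that by blast
qed

section \<open>The empirical measure and near-optimal couplings\<close>

text \<open>As a pmf the uniform index can be paired with an independent coin, and integrals become
  finite sums.\<close>

lemma empirical_measure_eq_pmf:
  assumes "n \<ge> 1"
  shows "empirical_measure n Z = distr (measure_pmf (pmf_of_set {1..n})) borel Z"
proof (rule measure_eqI)
  fix A assume "A \<in> sets (empirical_measure n Z)"
  then have "A \<in> sets borel" by (simp add: empirical_measure_def)
  then show "emeasure (empirical_measure n Z) A =
      emeasure (distr (measure_pmf (pmf_of_set {1..n})) borel Z) A"
    using assms
    by (simp add: empirical_measure_def emeasure_distr measurable_def sets_uniform_count_measure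
        space_uniform_count_measure emeasure_pmf_of_set emeasure_uniform_count_measure Int_commute
        divide_ennreal ennreal_of_nat_eq_real_of_nat)
qed (simp add: empirical_measure_def)

lemma nn_integral_empirical_measure:
  assumes "n \<ge> 1" "f \<in> borel_measurable borel" "\<And>z. 0 \<le> f z"
  shows "(\<integral>\<^sup>+ z. ennreal (f z) \<partial>empirical_measure n Z) = ennreal ((1 / real n) * (\<Sum>i=1..n. f (Z i)))"
  using assms
  by (simp add: empirical_measure_eq_pmf nn_integral_distr nn_integral_pmf_of_set sum_nonneg
        divide_ennreal ennreal_of_nat_eq_real_of_nat)

text \<open>Extracts a near-optimal coupling, so that no optimal one has to be shown to
  exist.\<close>

lemma ot_discrepancy_lessE:
  assumes "ot_discrepancy c P Q < t"
  obtains \<pi> where "\<pi> \<in> couplings P Q" "(\<integral>\<^sup>+ w. c (fst w) (snd w) \<partial>\<pi>) < t"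
  using assms by (auto simp: ot_discrepancy_def INF_less_iff case_prod_unfold)

section \<open>Worst-case loss at a fixed coefficient vector\<close>

context
  fixes L :: "real \<Rightarrow> real"
  assumes nonneg: "\<And>z. 0 \<le> L z"
    and lipschitz: "\<And>a b. L a \<le> L b + \<bar>a - b\<bar>"
    and ge_neg: "\<And>z. - z \<le> L z"
begin

lemma borel_measurable_margin_loss [measurable]:
  fixes \<beta> :: "real ^ 'd"
  shows "(\<lambda>(x, y). L (y * (\<beta> \<bullet> x))) \<in> borel_measurable borel"
proof -
  have "\<bar>L a - L b\<bar> \<le> \<bar>a - b\<bar>" for a b
    using lipschitz[of a b] lipschitz[of b a] by simp
  then have "1-lipschitz_on UNIV L"
    by (intro lipschitz_onI) (auto simp: dist_real_def)
  then have "continuous_on UNIV L" by (rule lipschitz_on_continuous_on)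
  then have "continuous_on UNIV (\<lambda>z :: (real ^ 'd) \<times> real. L (snd z * (\<beta> \<bullet> fst z)))"
    by (rule continuous_on_compose2) (auto intro!: continuous_intros)
  then show ?thesis
    by (simp add: case_prod_beta borel_measurable_continuous_onI)
qed

text \<open>For equal labels this is the Lipschitz property followed by Hoelder's inequality. For
  different labels the cost is infinite, which suffices unless the norm of \<beta> vanishes: then
  the product is \<open>0 * \<infinity> = 0\<close>, but all margins are 0 and the two losses
  agree.\<close>

lemma margin_loss_le_N_cost:
  fixes \<beta> x u :: "real ^ 'd"
  assumes "1 < q" "1 / p + 1 / q = 1" "\<bar>v\<bar> = 1"
  shows "ennreal (L (y * (\<beta> \<bullet> x)))
    \<le> ennreal (L (v * (\<beta> \<bullet> u))) + ennreal (lq_norm p \<beta>) * N_cost q (x, y) (u, v)"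
proof (cases "y = v")
  case True
  have "\<bar>v * (\<beta> \<bullet> x) - v * (\<beta> \<bullet> u)\<bar> = \<bar>\<beta> \<bullet> (x - u)\<bar>"
    using assms by (simp add: inner_diff_right right_diff_distrib[symmetric] abs_mult)
  also have "\<dots> \<le> lq_norm p \<beta> * lq_norm q (x - u)"
    using assms by (intro lq_norm_Hoelder)
  finally have "L (v * (\<beta> \<bullet> x)) \<le> L (v * (\<beta> \<bullet> u)) + lq_norm p \<beta> * lq_norm q (x - u)"
    using lipschitz[of "v * (\<beta> \<bullet> x)" "v * (\<beta> \<bullet> u)"] by simp
  then show ?thesis
    using True nonneg by (simp add: N_cost_def ennreal_mult[symmetric] lq_norm_nonneg
        ennreal_plus[symmetric] del: ennreal_plus)
next
  case False
  show ?thesis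
  proof (cases "lq_norm p \<beta> = 0")
    case True
    then have "\<beta> \<bullet> w = 0" for w
      using lq_norm_Hoelder[OF assms(1,2), of \<beta> w] by simp
    then show ?thesis by simp
  next
    case nz: False
    then show ?thesis
      using False lq_norm_nonneg[of p \<beta>] by (simp add: N_cost_def ennreal_mult_top)
  qed
qed

text \<open>The pointwise bound is integrated against a coupling whose cost is below
  \<open>\<delta> + \<eta>\<close>; the slack \<open>e\<close> absorbs the excess.\<close>

lemma worst_case_loss_le:
  fixes X :: "nat \<Rightarrow> real ^ 'd"
  assumes n: "n \<ge> 1" and Y: "\<And>i. i \<in> {1..n} \<Longrightarrow> Y i \<in> {-1, 1}" and \<delta>: "\<delta> > 0"
    and q: "1 < q" "1 / p + 1 / q = 1"
    and P: "P \<in> ot_ball (N_cost q) (empirical_measure n (\<lambda>i. (X i, Y i))) \<delta>"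
  shows "(\<integral>\<^sup>+ (x, y). ennreal (L (y * (\<beta> \<bullet> x))) \<partial>P)
    \<le> ennreal ((1 / real n) * (\<Sum>i=1..n. L (Y i * (\<beta> \<bullet> X i))) + \<delta> * lq_norm p \<beta>)"
proof (rule ennreal_le_epsilon)
  fix e :: real assume "e > 0"
  let ?Q = "empirical_measure n (\<lambda>i. (X i, Y i))"
  let ?K = "lq_norm p \<beta>"
  let ?f = "\<lambda>(x, y). L (y * (\<beta> \<bullet> x))"
  have K: "?K \<ge> 0" by (rule lq_norm_nonneg)
  \<comment> \<open>Adding 1 to the denominator keeps \<eta> positive when \<open>?K = 0\<close>,
    where division by \<open>?K\<close> would return 0.\<close>
  define \<eta> where "\<eta> = e / (?K + 1)"
  have "\<eta> > 0" using \<open>e > 0\<close> K by (simp add: \<eta>_def)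
  have "?K * \<eta> \<le> e"
    using \<open>e > 0\<close> K by (simp add: \<eta>_def field_simps)
  have "ot_discrepancy (N_cost q) P ?Q \<le> ennreal \<delta>"
    using P by (simp add: ot_ball_def)
  also have "\<dots> < ennreal (\<delta> + \<eta>)"
    using \<delta> \<open>\<eta> > 0\<close> by (simp add: ennreal_less_iff)
  finally obtain \<pi> where \<pi>: "\<pi> \<in> couplings P ?Q"
    and cost: "(\<integral>\<^sup>+ w. N_cost q (fst w) (snd w) \<partial>\<pi>) < ennreal (\<delta> + \<eta>)"
    by (rule ot_discrepancy_lessE)
  then have sets [measurable_cong]: "sets \<pi> = sets borel"
    and fst: "distr \<pi> borel fst = P" and snd: "distr \<pi> borel snd = ?Q"
    by (auto simp: couplings_def)
  have [measurable]: "fst \<in> borel_measurable \<pi>" "snd \<in> borel_measurable \<pi>"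
    unfolding measurable_cong_sets[OF sets refl]
    by (intro borel_measurable_continuous_onI continuous_intros)+
  \<comment> \<open>The pointwise bound asks for a label of modulus 1 only at the second point,
    whose law is the empirical measure; the property is then pulled back to \<pi>.\<close>
  have "AE z in ?Q. \<bar>snd z\<bar> = 1"
  proof -
    have [measurable]: "snd \<in> borel_measurable (borel :: ((real ^ 'd) \<times> real) measure)"
      by (intro borel_measurable_continuous_onI continuous_intros)
    have "\<forall>i\<in>{1..n}. \<bar>Y i\<bar> = 1" using Y by fastforce
    then show ?thesis
      using n by (subst empirical_measure_eq_pmf) (auto simp: AE_distr_iff AE_measure_pmf_iff)
  qed
  then have AE_label: "AE w in \<pi>. \<bar>snd (snd w)\<bar> = 1"
    unfolding snd[symmetric] by (rule AE_distrD[rotated]) simp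
  have "(\<integral>\<^sup>+ (x, y). ennreal (L (y * (\<beta> \<bullet> x))) \<partial>P) = (\<integral>\<^sup>+ z. ennreal (?f z) \<partial>distr \<pi> borel fst)"
    unfolding fst by (simp add: case_prod_unfold)
  also have "\<dots> = (\<integral>\<^sup>+ w. ennreal (?f (fst w)) \<partial>\<pi>)"
    by (subst nn_integral_distr) auto
  also have "\<dots> \<le> (\<integral>\<^sup>+ w. ennreal (?f (snd w)) + ennreal ?K * N_cost q (fst w) (snd w) \<partial>\<pi>)"
    using AE_label
  proof (intro nn_integral_mono_AE, eventually_elim)
    case (elim w)
    then show ?case
      using margin_loss_le_N_cost[OF q, of "snd (snd w)" "snd (fst w)" \<beta> "fst (fst w)" "fst (snd w)"]
      by (simp add: case_prod_beta)
  qed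
  also have "\<dots> = (\<integral>\<^sup>+ w. ennreal (?f (snd w)) \<partial>\<pi>)
      + ennreal ?K * (\<integral>\<^sup>+ w. N_cost q (fst w) (snd w) \<partial>\<pi>)"
    by (subst nn_integral_add) (auto simp: nn_integral_cmult)
  also have "(\<integral>\<^sup>+ w. ennreal (?f (snd w)) \<partial>\<pi>) = (\<integral>\<^sup>+ z. ennreal (?f z) \<partial>distr \<pi> borel snd)"
    by (subst nn_integral_distr) auto
  also have "\<dots> = ennreal ((1 / real n) * (\<Sum>i=1..n. L (Y i * (\<beta> \<bullet> X i))))"
    unfolding snd using n nonneg by (subst nn_integral_empirical_measure) (auto simp: case_prod_beta)
  also have "ennreal ?K * (\<integral>\<^sup>+ w. N_cost q (fst w) (snd w) \<partial>\<pi>) \<le> ennreal ?K * ennreal (\<delta> + \<eta>)"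
    using cost by (intro mult_left_mono) auto
  also have "ennreal ?K * ennreal (\<delta> + \<eta>) \<le> ennreal (\<delta> * ?K + e)"
    using \<open>?K * \<eta> \<le> e\<close> K \<delta> \<open>\<eta> > 0\<close>
    by (subst ennreal_mult[symmetric]) (auto intro!: ennreal_leI simp: algebra_simps simp del: ennreal_plus)
  finally show "(\<integral>\<^sup>+ (x, y). ennreal (L (y * (\<beta> \<bullet> x))) \<partial>P)
    \<le> ennreal ((1 / real n) * (\<Sum>i=1..n. L (Y i * (\<beta> \<bullet> X i))) + \<delta> * ?K) + ennreal e"
    using nonneg K \<delta> \<open>e > 0\<close>
    by (simp add: ennreal_plus[symmetric] sum_nonneg add_mono add.assoc del: ennreal_plus)
qed

text \<open>An explicit measure in the ball. The unmoved mass keeps \<open>1 - e\<close> of the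
  loss, and the moved mass is bounded below through \<open>- z \<le> L z\<close>.\<close>

lemma worst_case_loss_ge_approx:
  fixes X :: "nat \<Rightarrow> real ^ 'd"
  assumes n: "n \<ge> 1" and Y: "\<And>i. i \<in> {1..n} \<Longrightarrow> Y i \<in> {-1, 1}" and \<delta>: "\<delta> > 0"
    and q: "1 < q" "1 / p + 1 / q = 1" and e: "0 < e" "e < 1"
  obtains P where "P \<in> ot_ball (N_cost q) (empirical_measure n (\<lambda>i. (X i, Y i))) \<delta>"
    "ennreal ((1 / real n) * (\<Sum>i=1..n. (1 - e) * L (Y i * (\<beta> \<bullet> X i))
        - e * (Y i * (\<beta> \<bullet> X i)) + \<delta> * lq_norm p \<beta>))
      \<le> (\<integral>\<^sup>+ (x, y). ennreal (L (y * (\<beta> \<bullet> x))) \<partial>P)"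
proof -
  obtain h where h: "lq_norm q h \<le> 1" "\<beta> \<bullet> h = lq_norm p \<beta>"
    using lq_norm_dual_attained[OF q] .
  let ?Z = "\<lambda>i. (X i, Y i)"
  let ?Q = "empirical_measure n ?Z"
  let ?I = "pmf_of_set {1..n}"
  let ?J = "pair_pmf ?I (bernoulli_pmf e)"
  \<comment> \<open>The coin \<open>b\<close> shows \<open>True\<close> with probability
    \<open>e\<close>. The factor \<open>Y i\<close> in the shift makes the margin fall for either
    label.\<close>
  define W where "W = (\<lambda>(i, b). if b then (X i - (\<delta> / e * Y i) *\<^sub>R h, Y i) else ?Z i)"
  define P where "P = distr (measure_pmf ?J) borel W"
  \<comment> \<open>The joint law of the perturbed point and its original; its cost bounds the
    discrepancy from above.\<close>
  define \<pi> where "\<pi> = distr (measure_pmf ?J) borel (\<lambda>j. (W j, ?Z (fst j)))"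
  have "distr \<pi> borel fst = P"
    unfolding \<pi>_def P_def
    by (subst distr_distr)
       (auto intro!: borel_measurable_continuous_onI continuous_intros simp: comp_def)
  moreover have "distr \<pi> borel snd = ?Q"
  proof -
    have "distr \<pi> borel snd = distr (measure_pmf ?J) borel (?Z \<circ> fst)"
      unfolding \<pi>_def
      by (subst distr_distr)
         (auto intro!: borel_measurable_continuous_onI continuous_intros simp: comp_def)
    also have "\<dots> = distr (distr (measure_pmf ?J) (count_space UNIV) fst) borel ?Z"
      by (subst distr_distr) auto
    also have "\<dots> = ?Q"
      using n by (simp add: map_pmf_rep_eq[symmetric] map_fst_pair_pmf empirical_measure_eq_pmf)
    finally show ?thesis .
  qed
  ultimately have \<pi>: "\<pi> \<in> couplings P ?Q"
    by (auto simp: couplings_def \<pi>_def intro!: prob_space.prob_space_distr prob_space_measure_pmf)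
  have set_I: "set_pmf ?I = {1..n}" using n by simp
  have shift: "N_cost q (W (i, True)) (?Z i) \<le> ennreal (\<delta> / e)" "N_cost q (W (i, False)) (?Z i) = 0"
    if "i \<in> {1..n}" for i
  proof -
    have "\<bar>Y i\<bar> = 1" "q \<noteq> 0" using Y[OF that] q by auto
    then have "lq_norm q (- ((\<delta> / e * Y i) *\<^sub>R h)) \<le> \<delta> / e"
      using lq_norm_scaleR[of q "- (\<delta> / e * Y i)" h] h \<delta> e
      by (simp add: abs_mult mult_left_le divide_right_mono)
    then show "N_cost q (W (i, True)) (?Z i) \<le> ennreal (\<delta> / e)"
      by (simp add: W_def N_cost_def ennreal_leI)
    show "N_cost q (W (i, False)) (?Z i) = 0"
      using \<open>q \<noteq> 0\<close> lq_norm_scaleR[of q 0 h] by (simp add: W_def N_cost_def)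
  qed
  have "ot_discrepancy (N_cost q) P ?Q \<le> (\<integral>\<^sup>+ w. N_cost q (fst w) (snd w) \<partial>\<pi>)"
    unfolding ot_discrepancy_def case_prod_beta using \<pi> by (rule INF_lower)
  also have "\<dots> = (\<integral>\<^sup>+ j. N_cost q (W j) (?Z (fst j)) \<partial>?J)"
    unfolding \<pi>_def by (subst nn_integral_distr) auto
  also have "\<dots> = (\<integral>\<^sup>+ i. ennreal e * N_cost q (W (i, True)) (?Z i)
      + ennreal (1 - e) * N_cost q (W (i, False)) (?Z i) \<partial>?I)"
    using e by (subst nn_integral_pair_pmf') (simp add: mult.commute)
  \<comment> \<open>Probability \<open>e\<close> times distance at most \<open>\<delta> / e\<close>
    costs at most \<delta> at every index.\<close>
  also have "\<dots> \<le> (\<integral>\<^sup>+ i. ennreal \<delta> \<partial>?I)"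
  proof (intro nn_integral_mono_AE, unfold AE_measure_pmf_iff set_I, intro ballI)
    fix i assume i: "i \<in> {1..n}"
    have "ennreal e * N_cost q (W (i, True)) (?Z i) \<le> ennreal e * ennreal (\<delta> / e)"
      by (intro mult_left_mono shift i) simp
    also have "\<dots> = ennreal \<delta>"
      using e \<delta> by (subst ennreal_mult[symmetric]) auto
    finally show "ennreal e * N_cost q (W (i, True)) (?Z i)
      + ennreal (1 - e) * N_cost q (W (i, False)) (?Z i) \<le> ennreal \<delta>"
      using shift(2)[OF i] by simp
  qed
  finally have "ot_discrepancy (N_cost q) P ?Q \<le> ennreal \<delta>"
    by simp
  then have ball: "P \<in> ot_ball (N_cost q) ?Q \<delta>"
    by (auto simp: ot_ball_def P_def intro!: prob_space.prob_space_distr prob_space_measure_pmf)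
  let ?f = "\<lambda>(x, y). L (y * (\<beta> \<bullet> x))"
  let ?g = "\<lambda>i. (1 - e) * L (Y i * (\<beta> \<bullet> X i)) - e * (Y i * (\<beta> \<bullet> X i)) + \<delta> * lq_norm p \<beta>"
  \<comment> \<open>As \<open>Y i * Y i = 1\<close>, the shift lowers the margin by
    \<open>\<delta> / e * lq_norm p \<beta>\<close>; the weight \<open>e\<close> cancels the
    denominator.\<close>
  have pt: "?g i \<le> e * ?f (W (i, True)) + (1 - e) * ?f (W (i, False))" if "i \<in> {1..n}" for i
  proof -
    have "Y i * Y i = 1" using Y[OF that] by auto
    have "Y i * (\<beta> \<bullet> (X i - (\<delta> / e * Y i) *\<^sub>R h)) = Y i * (\<beta> \<bullet> X i) - (Y i * Y i) * (\<delta> / e * lq_norm p \<beta>)"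
      by (simp add: inner_diff_right h algebra_simps)
    then have "Y i * (\<beta> \<bullet> (X i - (\<delta> / e * Y i) *\<^sub>R h)) = Y i * (\<beta> \<bullet> X i) - \<delta> / e * lq_norm p \<beta>"
      by (simp add: \<open>Y i * Y i = 1\<close>)
    then have "?f (W (i, True)) \<ge> \<delta> / e * lq_norm p \<beta> - Y i * (\<beta> \<bullet> X i)"
      using ge_neg[of "Y i * (\<beta> \<bullet> X i) - \<delta> / e * lq_norm p \<beta>"] by (simp add: W_def)
    then have "e * ?f (W (i, True)) \<ge> e * (\<delta> / e * lq_norm p \<beta> - Y i * (\<beta> \<bullet> X i))"
      using e by (intro mult_left_mono) auto
    also have "e * (\<delta> / e * lq_norm p \<beta> - Y i * (\<beta> \<bullet> X i)) = \<delta> * lq_norm p \<beta> - e * (Y i * (\<beta> \<bullet> X i))"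
      using e by (simp add: right_diff_distrib)
    finally show ?thesis by (simp add: W_def)
  qed
  have f_nonneg: "0 \<le> ?f z" for z using nonneg by (simp add: case_prod_beta)
  have "ennreal ((1 / real n) * (\<Sum>i=1..n. ?g i))
      \<le> ennreal ((1 / real n) * (\<Sum>i=1..n. e * ?f (W (i, True)) + (1 - e) * ?f (W (i, False))))"
    by (intro ennreal_leI mult_left_mono sum_mono pt) auto
  also have "\<dots> = (\<integral>\<^sup>+ i. ennreal (e * ?f (W (i, True)) + (1 - e) * ?f (W (i, False))) \<partial>?I)"
    using n e f_nonneg by (subst nn_integral_pmf_of_set)
      (auto simp: sum_nonneg divide_ennreal ennreal_of_nat_eq_real_of_nat simp del: ennreal_plus)
  also have "\<dots> = (\<integral>\<^sup>+ j. ennreal (?f (W j)) \<partial>?J)"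
    using e f_nonneg
    by (subst nn_integral_pair_pmf') (simp add: mult.commute ennreal_mult ennreal_plus)
  also have "\<dots> = (\<integral>\<^sup>+ z. ennreal (?f z) \<partial>P)"
    unfolding P_def by (subst nn_integral_distr) auto
  finally show ?thesis
    using that[OF ball] by (simp add: case_prod_unfold)
qed

text \<open>The lower bounds approach the right-hand side as \<open>e\<close> tends to 0, so the
  supremum need not be attained.\<close>

lemma worst_case_loss_eq:
  fixes X :: "nat \<Rightarrow> real ^ 'd"
  assumes n: "n \<ge> 1" and Y: "\<And>i. i \<in> {1..n} \<Longrightarrow> Y i \<in> {-1, 1}" and \<delta>: "\<delta> > 0"
    and q: "1 < q" "1 / p + 1 / q = 1"
  shows "(SUP P\<in>ot_ball (N_cost q) (empirical_measure n (\<lambda>i. (X i, Y i))) \<delta>.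
      \<integral>\<^sup>+ (x, y). ennreal (L (y * (\<beta> \<bullet> x))) \<partial>P)
    = ennreal ((1 / real n) * (\<Sum>i=1..n. L (Y i * (\<beta> \<bullet> X i))) + \<delta> * lq_norm p \<beta>)"
    (is "?S = ennreal ?R")
proof (rule antisym)
  show "?S \<le> ennreal ?R"
    by (rule SUP_least) (rule worst_case_loss_le[OF assms])
  let ?g = "\<lambda>e. (1 / real n) * (\<Sum>i=1..n. (1 - e) * L (Y i * (\<beta> \<bullet> X i))
        - e * (Y i * (\<beta> \<bullet> X i)) + \<delta> * lq_norm p \<beta>)"
  \<comment> \<open>The limit is one-sided because \<open>e\<close> is a probability and a divisor;
    \<open>?g\<close> itself is continuous at 0.\<close>
  have "((\<lambda>e. ennreal (?g e)) \<longlongrightarrow> ennreal (?g 0)) (at_right 0)"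
    by (intro tendsto_intros tendsto_ennrealI)
  also have "?g 0 = ?R"
    using n by (simp add: sum.distrib field_simps)
  finally have lim: "((\<lambda>e. ennreal (?g e)) \<longlongrightarrow> ennreal ?R) (at_right 0)" .
  have "eventually (\<lambda>e. ennreal (?g e) \<le> ?S) (at_right 0)"
  proof (rule eventually_at_rightI[of 0 1])
    fix e :: real assume "e \<in> {0<..<1}"
    then have "0 < e" "e < 1" by auto
    with n Y \<delta> q obtain P where "P \<in> ot_ball (N_cost q) (empirical_measure n (\<lambda>i. (X i, Y i))) \<delta>"
      "ennreal (?g e) \<le> (\<integral>\<^sup>+ (x, y). ennreal (L (y * (\<beta> \<bullet> x))) \<partial>P)"
      by (rule worst_case_loss_ge_approx)
    then show "ennreal (?g e) \<le> ?S"
      by (rule SUP_upper2)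
  qed simp
  then show "ennreal ?R \<le> ?S"
    using lim by (intro tendsto_upperbound) auto
qed

end

section \<open>The logistic and hinge losses\<close>

text \<open>Multiplying \<open>1 + exp (- b)\<close> by \<open>exp \<bar>a - b\<bar>\<close>
  dominates \<open>1 + exp (- a)\<close> term by term; the logarithm turns the factor into a
  summand.\<close>

lemma logistic_lipschitz:
  fixes a b :: real
  shows "ln (1 + exp (- a)) \<le> ln (1 + exp (- b)) + \<bar>a - b\<bar>"
proof -
  have "1 + exp (- a) \<le> exp \<bar>a - b\<bar> + exp (- b + \<bar>a - b\<bar>)"
    by (intro add_mono) auto
  also have "\<dots> = (1 + exp (- b)) * exp \<bar>a - b\<bar>"
    by (simp add: ring_distribs flip: exp_add)
  finally have "ln (1 + exp (- a)) \<le> ln ((1 + exp (- b)) * exp \<bar>a - b\<bar>)"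
    by (intro ln_mono) (auto intro: add_pos_pos)
  also have "\<dots> = ln (1 + exp (- b)) + \<bar>a - b\<bar>"
    by (subst ln_mult) (auto simp: add_pos_pos less_imp_neq[symmetric])
  finally show ?thesis .
qed

lemma logistic_ge_neg: "- z \<le> ln (1 + exp (- z))" for z :: real
  by (subst ln_ge_iff) (auto intro: add_pos_pos)

theorem theorem2:
  fixes n :: nat and X :: "nat \<Rightarrow> real ^ 'd" and Y :: "nat \<Rightarrow> real"
    and \<delta> :: real and p q :: ennreal
  assumes "n \<ge> 1"
    and "\<And>i. i \<in> {1..n} \<Longrightarrow> Y i \<in> {-1, 1}"
    and "\<delta> > 0"
    and "1 < q"
    and "1 / p + 1 / q = 1"
  shows "(INF \<beta>\<in>(UNIV :: (real ^ 'd) set).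
            SUP P\<in>ot_ball (N_cost q) (empirical_measure n (\<lambda>i. (X i, Y i))) \<delta>.
              \<integral>\<^sup>+ (x, y). ennreal (ln (1 + exp (- y * (\<beta> \<bullet> x)))) \<partial>P)
       = (INF \<beta>\<in>(UNIV :: (real ^ 'd) set).
            ennreal ((1 / real n) * (\<Sum>i=1..n. ln (1 + exp (- Y i * (\<beta> \<bullet> X i))))
              + \<delta> * lq_norm p \<beta>))
     \<and> (INF \<beta>\<in>(UNIV :: (real ^ 'd) set).
            SUP P\<in>ot_ball (N_cost q) (empirical_measure n (\<lambda>i. (X i, Y i))) \<delta>.
              \<integral>\<^sup>+ (x, y). ennreal (max (1 - y * (\<beta> \<bullet> x)) 0) \<partial>P)
       = (INF \<beta>\<in>(UNIV :: (real ^ 'd) set).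
            ennreal ((1 / real n) * (\<Sum>i=1..n. max (1 - Y i * (\<beta> \<bullet> X i)) 0)
              + \<delta> * lq_norm p \<beta>))"
proof -
  \<comment> \<open>The equality holds for each \<beta> separately, so the infima agree without any
    minimax argument. The negated product matches the shape of \<open>L\<close>; simplification
    reconciles it with \<open>- y * (\<beta> \<bullet> x)\<close>.\<close>
  have logistic: "(SUP P\<in>ot_ball (N_cost q) (empirical_measure n (\<lambda>i. (X i, Y i))) \<delta>.
      \<integral>\<^sup>+ (x, y). ennreal (ln (1 + exp (- (y * (\<beta> \<bullet> x))))) \<partial>P)
    = ennreal ((1 / real n) * (\<Sum>i=1..n. ln (1 + exp (- (Y i * (\<beta> \<bullet> X i))))) + \<delta> * lq_norm p \<beta>)"
    for \<beta>
    by (rule worst_case_loss_eq[where L = "\<lambda>z. ln (1 + exp (- z))"])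
       (use assms logistic_lipschitz logistic_ge_neg in auto)
  have hinge: "(SUP P\<in>ot_ball (N_cost q) (empirical_measure n (\<lambda>i. (X i, Y i))) \<delta>.
      \<integral>\<^sup>+ (x, y). ennreal (max (1 - y * (\<beta> \<bullet> x)) 0) \<partial>P)
    = ennreal ((1 / real n) * (\<Sum>i=1..n. max (1 - Y i * (\<beta> \<bullet> X i)) 0) + \<delta> * lq_norm p \<beta>)"
    for \<beta>
    by (rule worst_case_loss_eq[where L = "\<lambda>z. max (1 - z) 0"]) (use assms in auto)
  show ?thesis
    using logistic hinge by simp
qed

end
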